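(* Let $F$ be the finite field of order $q$, and let $n,r,k$ be integers with $1\le k\le n$ and $0\le r\le n$. For $\alpha\in F$ let $f_{n,r,k}^{\alpha}$ be the number of $n\times n$ matrices $X=(x_{ij})$ over $F$ of rank $r$ with $x_{11}+\dots+x_{kk}=\alpha$. Then $$f_{n,r,k}^1=\frac{a(n,r,q)-g_{n,r,k}}{q},\qquad f_{n,r,k}^0=\frac{a(n,r,q)+(q-1)\,g_{n,r,k}}{q},$$ where $$g_{n,r,k}=\sum_{i=0}^{r}(-1)^{i}\,q^{\binom{i}{2}+k(r-i)}\,\binom{k}{i}_{q}\,a(n-k,r-i,q).$$
   Context: $a(n,r,q)$ denotes the number of $n\times n$ matrices of rank $r$ over $F$; explicitly $a(n,r,q)=\prod_{i=0}^{r-1}\frac{(q^{n}-q^{i})^{2}}{q^{r}-q^{i}}$. In particular $a(n,r,q)=0$ for $r>n$, and $a(0,0,q)=1$. $\binom{k}{i}_{q}$ denotes the Gaussian ($q$-)binomial coefficient, i.e. the number of $i$-dimensional subspaces of $F^{k}$ (zero if $i>k$). *)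

theory Defs
  imports "Jordan_Normal_Form.DL_Rank" "HOL-Library.Cardinality"
begin

text \<open>The finite field is the type \<open>'a\<close>, and its order \<open>q\<close> is \<open>CARD('a)\<close>. Matrices have
  indices starting at \<open>0\<close>, so the usual \<open>x\<^bsub>11\<^esub>, \<dots>, x\<^bsub>kk\<^esub>\<close> are the entries \<open>(j, j)\<close> with \<open>j < k\<close>.\<close>

text \<open>The number \<open>a(n,r,q)\<close> of rank \<open>r\<close> matrices; its product formula is a consequence, not part of
  the definition.\<close>

definition rank_count :: "'a::{field,finite} itself \<Rightarrow> nat \<Rightarrow> nat \<Rightarrow> nat" where
  "rank_count _ n r = card {X :: 'a mat. X \<in> carrier_mat n n \<and> vec_space.rank n X = r}"

text \<open>The Gaussian binomial coefficient as the number of \<open>i\<close>-dimensional subspaces of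
  \<open>F\<^sup>k\<close>. The record update turns a subspace into a vector space of its own.\<close>

definition gauss_binomial :: "'a::{field,finite} itself \<Rightarrow> nat \<Rightarrow> nat \<Rightarrow> nat" where
  "gauss_binomial _ k i = card {W :: 'a vec set.
     subspace class_ring W (module_vec TYPE('a) k) \<and>
     vectorspace.dim class_ring ((module_vec TYPE('a) k)\<lparr>carrier := W\<rparr>) = i}"

definition partial_trace_count :: "nat \<Rightarrow> nat \<Rightarrow> nat \<Rightarrow> 'a::{field,finite} \<Rightarrow> nat" where
  "partial_trace_count n r k \<alpha> =
     card {X. X \<in> carrier_mat n n \<and> vec_space.rank n X = r \<and> (\<Sum>j<k. X $$ (j, j)) = \<alpha>}"

definition g_sum :: "'a::{field,finite} itself \<Rightarrow> nat \<Rightarrow> nat \<Rightarrow> nat \<Rightarrow> int" where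
  "g_sum F n r k =
     (\<Sum>i=0..r. (-1) ^ i * int (CARD('a)) ^ ((i choose 2) + k * (r - i))
        * int (gauss_binomial F k i) * int (rank_count F (n - k) (r - i)))"

end

theory Submission
  imports Defs
begin

text \<open>
  For a weight \<open>\<phi> : F \<rightarrow> \<int>\<close> with \<open>\<Sum>x. \<phi> x = 0\<close>, let \<open>S(n, r, k)\<close> be the sum of
  \<open>\<phi>(x\<^sub>0\<^sub>0 + \<dots> + x\<^bsub>k-1,k-1\<^esub>)\<close> over the \<open>n \<times> n\<close> matrices of rank \<open>r\<close>. The heart of the proof is
  the recursion (\<open>weighted_count_Suc\<close>)
  \<open>S(n+1, r, k+1) = q\<^sup>r S(n, r, k) - q\<^bsup>r-1\<^esup> S(n, r-1, k)\<close>, without the second term if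
  \<open>r = 0\<close>. It is obtained by removing first a column and then a row.

  Write a matrix as \<open>(w | B)\<close> with first column \<open>w\<close>. The rank is that of \<open>B\<close> if \<open>w\<close> lies in the
  column space of \<open>B\<close>, and one more otherwise; the first diagonal entry is \<open>w\<^sub>0\<close>. On a subspace that
  is not contained in the hyperplane \<open>w\<^sub>0 = 0\<close> the coordinate \<open>w\<^sub>0\<close> is uniformly distributed over \<open>F\<close>,
  so the weights cancel. Hence the sum over all \<open>w\<close> vanishes, the sum over the \<open>w\<close> outside the
  column space is the negative of the sum over those inside, and the latter vanishes unless the first
  row of \<open>B\<close> is zero. If that row is zero, \<open>B\<close> is an \<open>n \<times> n\<close> matrix \<open>Y\<close> below a zero row, and each
  of the \<open>q\<^bsup>rank Y\<^esup>\<close> vectors \<open>w\<close> in the column space contributes the weight of the partial trace of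
  \<open>Y\<close> (\<open>sum_over_added_column\<close>, \<open>sum_first_coordinate_colspace_cons_row\<close>).

  The sum \<open>g\<close> satisfies the same recursion (\<open>g_sum_Suc\<close>): term by term this is the Pascal rule
  \<open>[k+1, i+1] = q\<^bsup>i+1\<^esup> [k, i+1] + [k, i]\<close> for Gaussian binomials, which is proved by sorting the
  subspaces of \<open>F\<^bsup>k+1\<^esup>\<close> according to whether they contain the first unit vector. For \<open>k = 0\<close> the
  partial trace is \<open>0\<close> and \<open>g(n, r, 0)\<close> is the number of matrices of rank \<open>r\<close>. So the identity
  \<open>S(n, r, k) = \<phi> 0 * g(n, r, k)\<close> holds for all \<open>k \<le> n\<close>.

  Taking \<open>\<phi>\<close> to be the difference of the indicators of \<open>0\<close> and \<open>1\<close> gives that \<open>f\<^sup>0 - f\<^sup>1\<close> is the value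
  of \<open>g\<close>. Scaling matrices shows that \<open>f\<^sup>\<alpha> = f\<^sup>1\<close> for every \<open>\<alpha> \<noteq> 0\<close>, so \<open>f\<^sup>0 + (q - 1) f\<^sup>1\<close> is the
  number of all matrices of rank \<open>r\<close>. These two linear equations determine \<open>f\<^sup>0\<close> and \<open>f\<^sup>1\<close>.

  Ranks and dimensions are handled throughout by counting: a subspace has dimension \<open>d\<close> exactly if it
  has \<open>q\<^sup>d\<close> elements.
\<close>

section \<open>Dimensions over a finite field as cardinalities\<close>

lemma (in vectorspace) basis_of_finite_carrier:
  assumes fin: "finite (carrier V)"
  obtains B where "finite B" "B \<subseteq> carrier V" "basis B" "card B = dim"
proof -
  have "gen_set (carrier V)"
    using in_own_span[of "carrier V"] span_is_subset2[of "carrier V"] by blast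
  then have "fin_dim" using fin unfolding fin_dim_def by blast
  from finite_basis_exists[OF this] obtain B where B: "finite B" "basis B" by blast
  then show ?thesis using that[of B] dim_basis[OF B] unfolding basis_def by auto
qed

text \<open>Coordinates with respect to a basis identify the space with the functions from the basis to the
  scalars.\<close>

lemma (in vectorspace) card_carrier_eq_power_dim:
  assumes fin: "finite (carrier V)"
  shows "card (carrier V) = card (carrier K) ^ dim"
proof -
  obtain B where B: "finite B" "B \<subseteq> carrier V" "basis B" "card B = dim"
    using basis_of_finite_carrier[OF fin] .
  have uniq: "\<forall>v. v \<in> carrier V \<longrightarrow> (\<exists>!a. a \<in> B \<rightarrow>\<^sub>E carrier K \<and> lincomb a B = v)"
    using basis_criterion[OF B(1,2)] B(3) by blast
  have "bij_betw (\<lambda>a. lincomb a B) (B \<rightarrow>\<^sub>E carrier K) (carrier V)"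
    unfolding bij_betw_def
  proof
    have closed: "lincomb a B \<in> carrier V" if "a \<in> B \<rightarrow>\<^sub>E carrier K" for a
      using that B(2) by (intro lincomb_closed) (auto simp: PiE_def)
    show "inj_on (\<lambda>a. lincomb a B) (B \<rightarrow>\<^sub>E carrier K)"
      using uniq closed by (intro inj_onI) blast
    show "(\<lambda>a. lincomb a B) ` (B \<rightarrow>\<^sub>E carrier K) = carrier V"
      using uniq closed by (auto simp: image_iff)
  qed
  then have "card (carrier V) = card (B \<rightarrow>\<^sub>E carrier K)"
    by (simp add: bij_betw_same_card)
  then show ?thesis by (simp add: card_PiE B(1,4))
qed

lemma carrier_vec_Suc: "carrier_vec (Suc n) = (\<lambda>(a, v). vCons a v) ` (UNIV \<times> carrier_vec n)"
proof -
  have "x \<in> (\<lambda>(a, v). vCons a v) ` (UNIV \<times> carrier_vec n)" if "x \<in> carrier_vec (Suc n)" for x :: "'a vec"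
    using that by (cases x) (auto simp: image_iff)
  then show ?thesis by auto
qed

lemma finite_carrier_vec [simp]: "finite (carrier_vec n :: 'a::finite vec set)"
proof (induction n)
  case 0
  have "(carrier_vec 0 :: 'a vec set) \<subseteq> {vNil}" by auto
  then show ?case using finite_subset by blast
next
  case (Suc n)
  then show ?case unfolding carrier_vec_Suc by simp
qed

lemma card_carrier_vec: "card (carrier_vec n :: 'a::finite vec set) = CARD('a) ^ n"
proof (induction n)
  case 0
  have "(carrier_vec 0 :: 'a vec set) = {vNil}" by auto
  then show ?case by simp
next
  case (Suc n)
  have "inj_on (\<lambda>(a, v). vCons a v) (UNIV \<times> (carrier_vec n :: 'a vec set))"
    by (auto simp: inj_on_def)
  then show ?case unfolding carrier_vec_Suc by (simp add: card_image card_cartesian_product Suc)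
qed

lemma finite_carrier_mat [simp]: "finite (carrier_mat n m :: 'a::finite mat set)"
proof -
  have "(carrier_mat n m :: 'a mat set) \<subseteq> (\<lambda>f. mat n m f) ` (({..<n} \<times> {..<m}) \<rightarrow>\<^sub>E UNIV)"
  proof
    fix X :: "'a mat" assume "X \<in> carrier_mat n m"
    then have "X = mat n m (restrict (\<lambda>p. X $$ p) ({..<n} \<times> {..<m}))"
      by (intro eq_matI) auto
    moreover have "restrict (\<lambda>p. X $$ p) ({..<n} \<times> {..<m}) \<in> ({..<n} \<times> {..<m}) \<rightarrow>\<^sub>E UNIV"
      by auto
    ultimately show "X \<in> (\<lambda>f. mat n m f) ` (({..<n} \<times> {..<m}) \<rightarrow>\<^sub>E UNIV)"
      by (rule image_eqI)
  qed
  then show ?thesis by (rule finite_subset) (intro finite_imageI finite_PiE; simp)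
qed

abbreviation is_subspace :: "nat \<Rightarrow> 'a::field vec set \<Rightarrow> bool" where
  "is_subspace n W \<equiv> subspace class_ring W (module_vec TYPE('a) n)"

lemma is_subspace_iff:
  "is_subspace n (W :: 'a::field vec set) \<longleftrightarrow>
     W \<subseteq> carrier_vec n \<and> 0\<^sub>v n \<in> W \<and> (\<forall>v\<in>W. \<forall>w\<in>W. v + w \<in> W) \<and> (\<forall>c. \<forall>v\<in>W. c \<cdot>\<^sub>v v \<in> W)"
proof -
  interpret vec_space "TYPE('a)" n .
  show ?thesis
    unfolding subspace_def submodule_def using vec_vs[of n] vec_module[of n]
    by (auto simp: module_vec_simps class_ring_simps)
qed

lemma is_subspace_finite: "is_subspace n (W :: 'a::{field,finite} vec set) \<Longrightarrow> finite W"
  unfolding is_subspace_iff by (meson finite_carrier_vec finite_subset)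

lemma card_subspace:
  assumes "is_subspace n (W :: 'a::{field,finite} vec set)"
  shows "card W = CARD('a) ^ vectorspace.dim class_ring ((module_vec TYPE('a) n)\<lparr>carrier := W\<rparr>)"
proof -
  interpret vec_space "TYPE('a)" n .
  interpret W: vectorspace class_ring "(module_vec TYPE('a) n)\<lparr>carrier := W\<rparr>"
    by (rule subspace_is_vs[OF assms])
  show ?thesis
    using W.card_carrier_eq_power_dim is_subspace_finite[OF assms] by (simp add: class_ring_simps)
qed

definition colspace :: "'a::field mat \<Rightarrow> 'a vec set" where
  "colspace X = (*\<^sub>v) X ` carrier_vec (dim_col X)"

lemma colspace_eq_span:
  assumes "X \<in> carrier_mat n m"
  shows "colspace X = LinearCombinations.module.span class_ring (module_vec TYPE('a::field) n) (set (cols (X :: 'a mat)))"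
proof -
  interpret vec_space "TYPE('a)" n .
  show ?thesis using col_space_eq[OF assms] assms unfolding colspace_def col_space_def by auto
qed

lemma colspace_is_subspace:
  assumes "(X :: 'a::field mat) \<in> carrier_mat n m"
  shows "is_subspace n (colspace X)"
proof -
  interpret vec_space "TYPE('a)" n .
  have "set (cols X) \<subseteq> carrier_vec n" using assms cols_dim by blast
  then show ?thesis unfolding colspace_eq_span[OF assms] using span_is_subspace by simp
qed

lemma card_colspace:
  assumes "(X :: 'a::{field,finite} mat) \<in> carrier_mat n m"
  shows "card (colspace X) = CARD('a) ^ vec_space.rank n X"
  using card_subspace[OF colspace_is_subspace[OF assms]]
  unfolding vec_space.rank_def colspace_eq_span[OF assms] .

lemma colspace_least:
  assumes "(X :: 'a::field mat) \<in> carrier_mat n m" "is_subspace n W" "\<And>j. j < m \<Longrightarrow> col X j \<in> W"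
  shows "colspace X \<subseteq> W"
proof -
  interpret vec_space "TYPE('a)" n .
  have "set (cols X) \<subseteq> W" using assms by (auto simp: cols_def)
  then show ?thesis
    unfolding colspace_eq_span[OF assms(1)]
    using span_is_subset assms(2) unfolding subspace_def by blast
qed

lemma one_less_card_field: "1 < CARD('a::{field,finite})"
proof -
  have "card {0::'a, 1} \<le> CARD('a)" by (rule card_mono) auto
  then show ?thesis by simp
qed

text \<open>The columns of \<open>M\<close> form a basis of \<open>W\<close>. That they span gives surjectivity; injectivity then
  follows from the equality of the two cardinalities.\<close>

lemma subspace_parametrization:
  assumes W: "is_subspace n (W :: 'a::{field,finite} vec set)" and card: "card W = CARD('a) ^ d"
  obtains M where "M \<in> carrier_mat n d" "bij_betw ((*\<^sub>v) M) (carrier_vec d) W"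
proof -
  interpret vec_space "TYPE('a)" n .
  interpret W: vectorspace class_ring "(module_vec TYPE('a) n)\<lparr>carrier := W\<rparr>"
    by (rule subspace_is_vs[OF W])
  have sub: "W \<subseteq> carrier_vec n" using W unfolding is_subspace_iff by blast
  have dim: "W.dim = d"
    using card_subspace[OF W] card one_less_card_field[where 'a='a] by simp
  have fin: "finite (carrier ((module_vec TYPE('a) n)\<lparr>carrier := W\<rparr>))"
    using is_subspace_finite[OF W] by simp
  obtain B where "finite B" "B \<subseteq> carrier ((module_vec TYPE('a) n)\<lparr>carrier := W\<rparr>)" "W.basis B" "card B = W.dim"
    using W.basis_of_finite_carrier[OF fin] .
  then have B: "finite B" "B \<subseteq> W" "card B = d" "W.span B = W"
    unfolding W.basis_def dim by simp_all
  obtain bs where bs: "set bs = B" "distinct bs" using finite_distinct_list[OF B(1)] by blast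
  have len: "length bs = d" using bs B(3) distinct_card by fastforce
  define M where "M = mat_of_cols n bs"
  have M: "M \<in> carrier_mat n d" unfolding M_def using len mat_of_cols_carrier(1) by blast
  have cols: "set (cols M) = B" unfolding M_def using bs B(2) sub by (simp add: cols_mat_of_cols)
  \<comment> \<open>Spans inside the subspace \<open>W\<close>, taken as a space of its own, agree with spans in the ambient space.\<close>
  have "colspace M = W"
    unfolding colspace_eq_span[OF M] cols
    using span_li_not_depend(1)[OF B(2)] W B(4) unfolding subspace_def by auto
  then have im: "(*\<^sub>v) M ` carrier_vec d = W" using M unfolding colspace_def by simp
  moreover have "inj_on ((*\<^sub>v) M) (carrier_vec d)"
    by (rule eq_card_imp_inj_on) (simp_all add: im card card_carrier_vec)
  ultimately show ?thesis using that[OF M] unfolding bij_betw_def by blast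
qed

text \<open>Subspaces can be sorted by cardinality instead of dimension because \<open>d \<mapsto> q\<^sup>d\<close> is injective.\<close>

lemma gauss_binomial_eq_card:
  "gauss_binomial TYPE('a::{field,finite}) k i
     = card {W :: 'a vec set. is_subspace k W \<and> card W = CARD('a) ^ i}"
  unfolding gauss_binomial_def
  by (rule arg_cong[of _ _ card]) (use card_subspace one_less_card_field[where 'a='a] in \<open>auto\<close>)

section \<open>Adding a row or a column to a matrix\<close>

definition cons_row :: "'a vec \<Rightarrow> 'a mat \<Rightarrow> 'a mat" where
  "cons_row u Y = mat (Suc (dim_row Y)) (dim_col Y) (\<lambda>(i, j). if i = 0 then u $ j else Y $$ (i - 1, j))"

definition cons_col :: "'a vec \<Rightarrow> 'a mat \<Rightarrow> 'a mat" where
  "cons_col w B = mat (dim_row B) (Suc (dim_col B)) (\<lambda>(i, j). if j = 0 then w $ i else B $$ (i, j - 1))"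

lemma cons_row_carrier [simp]: "Y \<in> carrier_mat n m \<Longrightarrow> cons_row u Y \<in> carrier_mat (Suc n) m"
  unfolding cons_row_def by auto

lemma cons_col_carrier [simp]: "B \<in> carrier_mat n m \<Longrightarrow> cons_col w B \<in> carrier_mat n (Suc m)"
  unfolding cons_col_def by auto

lemma bij_betw_cons_row:
  "bij_betw (\<lambda>(u, Y). cons_row u Y) (carrier_vec m \<times> carrier_mat n m)
     (carrier_mat (Suc n) m :: 'a mat set)"
proof (rule bij_betwI[where g = "\<lambda>X. (vec m (\<lambda>j. X $$ (0, j)), mat n m (\<lambda>(i, j). X $$ (Suc i, j)))"])
  fix p :: "'a vec \<times> 'a mat" assume "p \<in> carrier_vec m \<times> carrier_mat n m"
  then show "(\<lambda>X. (vec m (\<lambda>j. X $$ (0, j)), mat n m (\<lambda>(i, j). X $$ (Suc i, j))))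
      ((\<lambda>(u, Y). cons_row u Y) p) = p"
    by (cases p) (auto simp: cons_row_def)
next
  fix X :: "'a mat" assume "X \<in> carrier_mat (Suc n) m"
  then show "(\<lambda>(u, Y). cons_row u Y)
      ((\<lambda>X. (vec m (\<lambda>j. X $$ (0, j)), mat n m (\<lambda>(i, j). X $$ (Suc i, j)))) X) = X"
    by (auto simp: cons_row_def)
qed auto

lemma bij_betw_cons_col:
  "bij_betw (\<lambda>(w, B). cons_col w B) (carrier_vec n \<times> carrier_mat n m)
     (carrier_mat n (Suc m) :: 'a mat set)"
proof (rule bij_betwI[where g = "\<lambda>X. (vec n (\<lambda>i. X $$ (i, 0)), mat n m (\<lambda>(i, j). X $$ (i, Suc j)))"])
  fix p :: "'a vec \<times> 'a mat" assume "p \<in> carrier_vec n \<times> carrier_mat n m"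
  then show "(\<lambda>X. (vec n (\<lambda>i. X $$ (i, 0)), mat n m (\<lambda>(i, j). X $$ (i, Suc j))))
      ((\<lambda>(w, B). cons_col w B) p) = p"
    by (cases p) (auto simp: cons_col_def)
next
  fix X :: "'a mat" assume "X \<in> carrier_mat n (Suc m)"
  then show "(\<lambda>(w, B). cons_col w B)
      ((\<lambda>X. (vec n (\<lambda>i. X $$ (i, 0)), mat n m (\<lambda>(i, j). X $$ (i, Suc j)))) X) = X"
    by (auto simp: cons_col_def)
qed auto

lemma cons_row_mult_vec:
  assumes "u \<in> carrier_vec m" "Y \<in> carrier_mat n m" "v \<in> carrier_vec m"
  shows "cons_row u Y *\<^sub>v v = vCons (u \<bullet> v) (Y *\<^sub>v v)"
proof (rule eq_vecI)
  fix i assume "i < dim_vec (vCons (u \<bullet> v) (Y *\<^sub>v v))"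
  then show "(cons_row u Y *\<^sub>v v) $ i = vCons (u \<bullet> v) (Y *\<^sub>v v) $ i"
    using assms by (cases i) (auto simp: cons_row_def scalar_prod_def intro!: sum.cong)
qed (use assms in \<open>auto simp: cons_row_def\<close>)

lemma cons_col_mult_vCons:
  fixes B :: "'a::comm_ring_1 mat"
  assumes "w \<in> carrier_vec n" "B \<in> carrier_mat n m" "v \<in> carrier_vec m"
  shows "cons_col w B *\<^sub>v vCons a v = a \<cdot>\<^sub>v w + B *\<^sub>v v"
proof (rule eq_vecI)
  fix i assume i: "i < dim_vec (a \<cdot>\<^sub>v w + B *\<^sub>v v)"
  then have "row (cons_col w B) i = vCons (w $ i) (row B i)"
    using assms by (auto intro!: eq_vecI simp: cons_col_def vec_index_vCons)
  then show "(cons_col w B *\<^sub>v vCons a v) $ i = (a \<cdot>\<^sub>v w + B *\<^sub>v v) $ i"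
    using assms i by (simp add: cons_col_def)
qed (use assms in \<open>auto simp: cons_col_def\<close>)

lemma rank_eqI:
  assumes "(X :: 'a::{field,finite} mat) \<in> carrier_mat n m" "card (colspace X) = CARD('a) ^ r"
  shows "vec_space.rank n X = r"
  using card_colspace[OF assms(1)] assms(2) one_less_card_field[where 'a='a] by simp

lemma colspace_eqI: "X \<in> carrier_mat n m \<Longrightarrow> colspace X = (*\<^sub>v) X ` carrier_vec m"
  unfolding colspace_def by auto

text \<open>The column space only gains a zero coordinate.\<close>

lemma rank_cons_row_zero:
  assumes "(Y :: 'a::{field,finite} mat) \<in> carrier_mat n m"
  shows "vec_space.rank (Suc n) (cons_row (0\<^sub>v m) Y) = vec_space.rank n Y"
proof (rule rank_eqI[OF cons_row_carrier[OF assms]])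
  have "colspace (cons_row (0\<^sub>v m) Y) = vCons 0 ` colspace Y"
    unfolding colspace_eqI[OF cons_row_carrier[OF assms]] colspace_eqI[OF assms] image_image
    using assms by (intro image_cong) (simp_all add: cons_row_mult_vec[where m = m and n = n])
  then show "card (colspace (cons_row (0\<^sub>v m) Y)) = CARD('a) ^ vec_space.rank n Y"
    by (simp add: card_image inj_on_def card_colspace[OF assms])
qed

lemma colspace_cons_col:
  assumes w: "w \<in> carrier_vec n" and B: "(B :: 'a::field mat) \<in> carrier_mat n m"
  shows "colspace (cons_col w B) = (\<lambda>(a, b). a \<cdot>\<^sub>v w + b) ` (UNIV \<times> colspace B)"
proof -
  have "colspace (cons_col w B) = (\<lambda>(a, v). a \<cdot>\<^sub>v w + B *\<^sub>v v) ` (UNIV \<times> carrier_vec m)"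
    unfolding colspace_eqI[OF cons_col_carrier[OF B]] carrier_vec_Suc image_image
    by (rule image_cong) (auto simp: cons_col_mult_vCons[OF w B])
  also have "\<dots> = (\<lambda>(a, b). a \<cdot>\<^sub>v w + b) ` (UNIV \<times> colspace B)"
    unfolding colspace_eqI[OF B] by force
  finally show ?thesis .
qed

text \<open>If \<open>w\<close> lies outside the column space \<open>C\<close> of \<open>B\<close>, the translates \<open>a w + C\<close> for the \<open>q\<close>
  scalars \<open>a\<close> are disjoint, so the column space grows by the factor \<open>q\<close>.\<close>

lemma rank_cons_col:
  assumes w: "w \<in> carrier_vec n" and B: "(B :: 'a::{field,finite} mat) \<in> carrier_mat n m"
  shows "vec_space.rank n (cons_col w B) = (if w \<in> colspace B then vec_space.rank n B else Suc (vec_space.rank n B))"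
proof (rule rank_eqI[OF cons_col_carrier[OF B]])
  note sub = colspace_is_subspace[OF B, unfolded is_subspace_iff]
  show "card (colspace (cons_col w B)) = CARD('a) ^ (if w \<in> colspace B then vec_space.rank n B else Suc (vec_space.rank n B))"
  proof (cases "w \<in> colspace B")
    case True
    have "b \<in> (\<lambda>(a, b). a \<cdot>\<^sub>v w + b) ` (UNIV \<times> colspace B)" if "b \<in> colspace B" for b
    proof (rule image_eqI)
      show "b = (case (0, b) of (a, b) \<Rightarrow> a \<cdot>\<^sub>v w + b)"
        using that w sub by (intro eq_vecI) auto
    qed (use that in simp)
    then have "colspace (cons_col w B) = colspace B"
      unfolding colspace_cons_col[OF w B] using sub True by auto
    then show ?thesis using True by (simp add: card_colspace[OF B])
  next
    case False
    have "inj_on (\<lambda>(a, b). a \<cdot>\<^sub>v w + b) (UNIV \<times> colspace B)"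
    proof (rule inj_onI, clarify)
      fix a a' :: 'a and b b'
      assume bb: "b \<in> colspace B" "b' \<in> colspace B" and eq: "a \<cdot>\<^sub>v w + b = a' \<cdot>\<^sub>v w + b'"
      have c: "b \<in> carrier_vec n" "b' \<in> carrier_vec n" using bb sub by auto
      have ix: "a * w $ i + b $ i = a' * w $ i + b' $ i" if "i < n" for i
        using arg_cong[OF eq, of "\<lambda>v. v $ i"] that c w by simp
      have "a = a'"
      proof (rule ccontr)
        assume ne: "a \<noteq> a'"
        have "w = inverse (a - a') \<cdot>\<^sub>v (b' + (-1) \<cdot>\<^sub>v b)"
        proof (rule eq_vecI)
          fix i assume "i < dim_vec (inverse (a - a') \<cdot>\<^sub>v (b' + (-1) \<cdot>\<^sub>v b))"
          then have i: "i < n" using c by simp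
          have "(a - a') * w $ i = b' $ i - b $ i" using ix[OF i] by (simp add: algebra_simps)
          then show "w $ i = (inverse (a - a') \<cdot>\<^sub>v (b' + (-1) \<cdot>\<^sub>v b)) $ i"
            using i c ne by (simp add: field_simps)
        qed (use w c in simp)
        moreover have "inverse (a - a') \<cdot>\<^sub>v (b' + (-1) \<cdot>\<^sub>v b) \<in> colspace B" using sub bb by blast
        ultimately show False using False by simp
      qed
      moreover from this have "b = b'" using c ix by (intro eq_vecI) auto
      ultimately show "a = a' \<and> b = b'" by simp
    qed
    then have "card (colspace (cons_col w B)) = CARD('a) * card (colspace B)"
      unfolding colspace_cons_col[OF w B] by (simp add: card_image card_cartesian_product)
    then show ?thesis using False by (simp add: card_colspace[OF B])
  qed
qed

section \<open>Cancellation of weights and the recursion for weighted counts\<close>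

text \<open>Translating \<open>W\<close> by the multiples of a vector whose first coordinate is \<open>1\<close> shows that the sum
  does not depend on the shift \<open>t\<close>; averaging over all shifts replaces every summand by
  \<open>\<Sum>x. \<phi> x = 0\<close>. This plays the part of the orthogonality of additive characters, with an integer
  weight in place of a character.\<close>

lemma sum_shifted_first_coordinate_eq_0:
  fixes \<phi> :: "'a::{field,finite} \<Rightarrow> int"
  assumes W: "is_subspace n W" and w: "w \<in> W" "w $ 0 \<noteq> 0" and n: "0 < n"
    and \<phi>: "(\<Sum>x\<in>UNIV. \<phi> x) = 0"
  shows "(\<Sum>v\<in>W. \<phi> (v $ 0 + t)) = 0"
proof -
  note sub = W[unfolded is_subspace_iff]
  define e where "e = inverse (w $ 0) \<cdot>\<^sub>v w"
  have e: "e \<in> W" "e \<in> carrier_vec n" "e $ 0 = 1" using w sub n unfolding e_def by auto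
  have shift: "(\<Sum>v\<in>W. \<phi> (v $ 0 + t)) = (\<Sum>v\<in>W. \<phi> (v $ 0 + t + s))" for s
  proof (rule sum.reindex_bij_witness[of _ "\<lambda>v. v + s \<cdot>\<^sub>v e" "\<lambda>v. v + (- s) \<cdot>\<^sub>v e"])
    fix v assume v: "v \<in> W"
    then have c: "v \<in> carrier_vec n" using sub by blast
    show "v + (- s) \<cdot>\<^sub>v e + s \<cdot>\<^sub>v e = v" "v + s \<cdot>\<^sub>v e + (- s) \<cdot>\<^sub>v e = v"
      using c e by (auto intro!: eq_vecI)
    show "v + (- s) \<cdot>\<^sub>v e \<in> W" "v + s \<cdot>\<^sub>v e \<in> W" using sub v e by blast+
    show "\<phi> ((v + (- s) \<cdot>\<^sub>v e) $ 0 + t + s) = \<phi> (v $ 0 + t)" using c e n by simp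
  qed
  have "int CARD('a) * (\<Sum>v\<in>W. \<phi> (v $ 0 + t)) = (\<Sum>s::'a\<in>UNIV. \<Sum>v\<in>W. \<phi> (v $ 0 + t + s))"
    by (simp flip: shift)
  also have "\<dots> = (\<Sum>v\<in>W. \<Sum>s\<in>UNIV. \<phi> (v $ 0 + t + s))" by (rule sum.swap)
  also have "(\<Sum>s\<in>UNIV. \<phi> (c + s)) = 0" for c
    using sum.reindex_bij_witness[of UNIV "\<lambda>x. x - c" "\<lambda>x. c + x" UNIV \<phi> "\<lambda>s. \<phi> (c + s)"] \<phi> by simp
  then have "(\<Sum>v\<in>W. \<Sum>s\<in>UNIV. \<phi> (v $ 0 + t + s)) = 0" by simp
  finally show ?thesis by simp
qed

text \<open>The first coordinates of the column space are the values \<open>u \<bullet> v\<close>. They all vanish if \<open>u = 0\<close>,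
  and otherwise some column has a nonzero first coordinate, so the weights cancel.\<close>

lemma sum_first_coordinate_colspace_cons_row:
  fixes \<phi> :: "'a::{field,finite} \<Rightarrow> int"
  assumes u: "u \<in> carrier_vec m" and Y: "Y \<in> carrier_mat n m" and \<phi>: "(\<Sum>x\<in>UNIV. \<phi> x) = 0"
  shows "(\<Sum>v\<in>colspace (cons_row u Y). \<phi> (v $ 0 + t))
    = (if u = 0\<^sub>v m then int CARD('a) ^ vec_space.rank n Y * \<phi> t else 0)"
proof (cases "u = 0\<^sub>v m")
  case True
  have "v $ 0 = 0" if "v \<in> colspace (cons_row u Y)" for v
    using that Y unfolding True colspace_eqI[OF cons_row_carrier[OF Y]]
    by (auto simp: cons_row_mult_vec[of _ m _ n])
  then have "(\<Sum>v\<in>colspace (cons_row u Y). \<phi> (v $ 0 + t)) = int (card (colspace (cons_row u Y))) * \<phi> t"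
    by simp
  then show ?thesis
    using True by (simp add: card_colspace[OF cons_row_carrier[OF Y]] rank_cons_row_zero[OF Y])
next
  case False
  then obtain j where j: "j < m" "u $ j \<noteq> 0" using u by (metis eq_vecI carrier_vecD index_zero_vec)
  let ?w = "cons_row u Y *\<^sub>v unit_vec m j"
  have "?w \<in> colspace (cons_row u Y)" unfolding colspace_eqI[OF cons_row_carrier[OF Y]] by simp
  moreover have "?w $ 0 \<noteq> 0" using j u by (simp add: cons_row_mult_vec[OF u Y])
  ultimately show ?thesis
    using sum_shifted_first_coordinate_eq_0[OF colspace_is_subspace[OF cons_row_carrier[OF Y]] _ _ _ \<phi>] False
    by simp
qed

definition weighted_count :: "('a::{field,finite} \<Rightarrow> int) \<Rightarrow> nat \<Rightarrow> nat \<Rightarrow> nat \<Rightarrow> int" where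
  "weighted_count \<phi> n r k =
     (\<Sum>X\<in>carrier_mat n n. of_bool (vec_space.rank n X = r) * \<phi> (\<Sum>j<k. X $$ (j, j)))"

text \<open>The sum over all columns \<open>w\<close> is zero by cancellation on the whole space. So the columns outside
  the column space of \<open>B\<close>, which raise the rank, contribute the negative of what the columns inside
  contribute.\<close>

lemma sum_over_added_column:
  fixes \<phi> :: "'a::{field,finite} \<Rightarrow> int"
  assumes B: "B \<in> carrier_mat n m" and n: "0 < n" and \<phi>: "(\<Sum>x\<in>UNIV. \<phi> x) = 0"
  shows "(\<Sum>w\<in>carrier_vec n. of_bool (vec_space.rank n (cons_col w B) = r) * \<phi> (w $ 0 + t))
    = (of_bool (vec_space.rank n B = r) - of_bool (Suc (vec_space.rank n B) = r))
        * (\<Sum>w\<in>colspace B. \<phi> (w $ 0 + t))"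
proof -
  have sub: "colspace B \<subseteq> carrier_vec n"
    using colspace_is_subspace[OF B] unfolding is_subspace_iff by blast
  have V: "is_subspace n (carrier_vec n :: 'a vec set)" unfolding is_subspace_iff by auto
  have all: "(\<Sum>w\<in>carrier_vec n. \<phi> (w $ 0 + t)) = 0"
    by (rule sum_shifted_first_coordinate_eq_0[OF V _ _ n \<phi>, of "unit_vec n 0"]) (use n in auto)
  let ?b = "\<lambda>s. of_bool (s = r) :: int" and ?R = "vec_space.rank n B"
  \<comment> \<open>The summand is written as if every \<open>w\<close> raised the rank, with a correction on the column space;
    the uncorrected part has total zero.\<close>
  have "(\<Sum>w\<in>carrier_vec n. ?b (vec_space.rank n (cons_col w B)) * \<phi> (w $ 0 + t))
    = (\<Sum>w\<in>carrier_vec n. (if w \<in> colspace B then (?b ?R - ?b (Suc ?R)) * \<phi> (w $ 0 + t) else 0)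
          + ?b (Suc ?R) * \<phi> (w $ 0 + t))"
    by (rule sum.cong) (simp_all add: rank_cons_col[OF _ B] algebra_simps)
  also have "\<dots> = (\<Sum>w\<in>carrier_vec n. if w \<in> colspace B then (?b ?R - ?b (Suc ?R)) * \<phi> (w $ 0 + t) else 0)"
    by (simp add: sum.distrib all flip: sum_distrib_left)
  also have "\<dots> = (\<Sum>w\<in>colspace B. (?b ?R - ?b (Suc ?R)) * \<phi> (w $ 0 + t))"
    using sub by (simp add: sum.inter_restrict[symmetric] Int_absorb1)
  finally show ?thesis by (simp add: sum_distrib_left)
qed

lemma trace_cons_col_cons_row:
  assumes "Y \<in> carrier_mat n n" "k \<le> n"
  shows "(\<Sum>j<Suc k. cons_col w (cons_row u Y) $$ (j, j)) = w $ 0 + (\<Sum>j<k. Y $$ (j, j))"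
proof -
  have "cons_col w (cons_row u Y) $$ (Suc j, Suc j) = Y $$ (j, j)" if "j < k" for j
    using assms that by (simp add: cons_col_def cons_row_def)
  moreover have "cons_col w (cons_row u Y) $$ (0, 0) = w $ 0"
    using assms by (simp add: cons_col_def cons_row_def)
  ultimately show ?thesis by (simp add: sum.lessThan_Suc_shift del: sum.lessThan_Suc)
qed

text \<open>Only the matrices whose first row is zero behind the first column survive the cancellation, and
  they contribute with \<open>r = rank Y\<close> positively and with \<open>r = rank Y + 1\<close> negatively.\<close>

lemma weighted_count_Suc:
  fixes \<phi> :: "'a::{field,finite} \<Rightarrow> int"
  assumes k: "k \<le> n" and \<phi>: "(\<Sum>x\<in>UNIV. \<phi> x) = 0"
  shows "weighted_count \<phi> (Suc n) r (Suc k) = int CARD('a) ^ r * weighted_count \<phi> n r k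
    - (if r = 0 then 0 else int CARD('a) ^ (r - 1) * weighted_count \<phi> n (r - 1) k)"
proof -
  let ?N = "Suc n" and ?T = "\<lambda>Y :: 'a mat. \<Sum>j<k. Y $$ (j, j)"
  let ?f = "\<lambda>X. of_bool (vec_space.rank ?N X = r) * \<phi> (\<Sum>j<Suc k. X $$ (j, j))"
  let ?c = "\<lambda>s. of_bool (s = r) - of_bool (Suc s = r) :: int"
  have "weighted_count \<phi> ?N r (Suc k) = (\<Sum>(w, B)\<in>carrier_vec ?N \<times> carrier_mat ?N n. ?f (cons_col w B))"
    unfolding weighted_count_def
    by (subst sum.reindex_bij_betw[OF bij_betw_cons_col, symmetric]) (simp add: case_prod_unfold)
  also have "\<dots> = (\<Sum>B\<in>carrier_mat ?N n. \<Sum>w\<in>carrier_vec ?N. ?f (cons_col w B))"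
    by (subst sum.cartesian_product[symmetric]) (rule sum.swap)
  also have "\<dots> = (\<Sum>(u, Y)\<in>carrier_vec n \<times> carrier_mat n n. \<Sum>w\<in>carrier_vec ?N. ?f (cons_col w (cons_row u Y)))"
    by (subst sum.reindex_bij_betw[OF bij_betw_cons_row, symmetric]) (simp add: case_prod_unfold)
  also have "\<dots> = (\<Sum>p\<in>carrier_vec n \<times> carrier_mat n n. case p of (u :: 'a vec, Y) \<Rightarrow>
      if u = 0\<^sub>v n then ?c (vec_space.rank n Y) * (int CARD('a) ^ vec_space.rank n Y * \<phi> (?T Y)) else 0)"
  proof (rule sum.cong[OF refl])
    fix p :: "'a vec \<times> 'a mat" assume "p \<in> carrier_vec n \<times> carrier_mat n n"
    then obtain u Y where p: "p = (u, Y)" and u: "u \<in> carrier_vec n" and Y: "Y \<in> carrier_mat n n" by blast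
    show "(case p of (u, Y) \<Rightarrow> \<Sum>w\<in>carrier_vec ?N. ?f (cons_col w (cons_row u Y)))
      = (case p of (u, Y) \<Rightarrow>
          if u = 0\<^sub>v n then ?c (vec_space.rank n Y) * (int CARD('a) ^ vec_space.rank n Y * \<phi> (?T Y)) else 0)"
      unfolding p prod.case trace_cons_col_cons_row[OF Y k]
        sum_over_added_column[OF cons_row_carrier[OF Y] zero_less_Suc \<phi>]
        sum_first_coordinate_colspace_cons_row[OF u Y \<phi>]
      by (simp add: rank_cons_row_zero[OF Y])
  qed
  also have "\<dots> = (\<Sum>Y\<in>carrier_mat n n. \<Sum>u\<in>(carrier_vec n :: 'a vec set).
      if u = 0\<^sub>v n then ?c (vec_space.rank n Y) * (int CARD('a) ^ vec_space.rank n Y * \<phi> (?T Y)) else 0)"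
    by (subst sum.cartesian_product[symmetric]) (rule sum.swap)
  also have "\<dots> = (\<Sum>Y\<in>carrier_mat n n. ?c (vec_space.rank n Y) * (int CARD('a) ^ vec_space.rank n Y * \<phi> (?T Y)))"
    by simp
  also have "\<dots> = (\<Sum>Y\<in>carrier_mat n n. int CARD('a) ^ r * (of_bool (vec_space.rank n Y = r) * \<phi> (?T Y))
      - (if r = 0 then 0 else int CARD('a) ^ (r - 1) * (of_bool (vec_space.rank n Y = r - 1) * \<phi> (?T Y))))"
  proof (rule sum.cong[OF refl])
    fix Y :: "'a mat"
    consider "vec_space.rank n Y = r" | "Suc (vec_space.rank n Y) = r"
      | "vec_space.rank n Y \<noteq> r" "Suc (vec_space.rank n Y) \<noteq> r" by blast
    then show "?c (vec_space.rank n Y) * (int CARD('a) ^ vec_space.rank n Y * \<phi> (?T Y))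
      = int CARD('a) ^ r * (of_bool (vec_space.rank n Y = r) * \<phi> (?T Y))
        - (if r = 0 then 0 else int CARD('a) ^ (r - 1) * (of_bool (vec_space.rank n Y = r - 1) * \<phi> (?T Y)))"
      by cases auto
  qed
  also have "\<dots> = int CARD('a) ^ r * weighted_count \<phi> n r k
    - (if r = 0 then 0 else int CARD('a) ^ (r - 1) * weighted_count \<phi> n (r - 1) k)"
    unfolding weighted_count_def by (cases "r = 0") (simp_all add: sum_subtractf sum_distrib_left del: sum_of_bool_mult_eq)
  finally show ?thesis .
qed

section \<open>The Pascal rule for Gaussian binomials\<close>

abbreviation subspaces_of_dim :: "nat \<Rightarrow> nat \<Rightarrow> 'a::{field,finite} vec set set" where
  "subspaces_of_dim k i \<equiv> {W :: 'a vec set. is_subspace k W \<and> card W = CARD('a) ^ i}"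

lemma finite_subspaces_of_dim: "finite (subspaces_of_dim k i :: 'a::{field,finite} vec set set)"
  by (rule finite_subset[of _ "Pow (carrier_vec k)"]) (auto simp: is_subspace_iff)

lemma vCons_add: "dim_vec v = dim_vec w \<Longrightarrow> vCons a v + vCons b w = vCons (a + b) (v + w)"
  by (rule eq_vecI) (auto simp: vec_index_vCons)

lemma vCons_smult: "c \<cdot>\<^sub>v vCons a v = vCons (c * a) (c \<cdot>\<^sub>v v)"
  by (rule eq_vecI) (auto simp: vec_index_vCons)

text \<open>A subspace containing the first unit vector is closed under changing the first coordinate, so it
  is the full cylinder over a subspace of one dimension less.\<close>

lemma card_subspaces_containing_first_unit:
  "card {W :: 'a::{field,finite} vec set \<in> subspaces_of_dim (Suc k) (Suc i). vCons 1 (0\<^sub>v k) \<in> W}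
     = card (subspaces_of_dim k i :: 'a vec set set)"
proof -
  let ?e = "vCons 1 (0\<^sub>v k) :: 'a vec"
  let ?f = "\<lambda>U :: 'a vec set. (\<lambda>(a, v). vCons a v) ` (UNIV \<times> U)"
  let ?g = "\<lambda>W :: 'a vec set. {v. vCons 0 v \<in> W}"
  have card_f: "card (?f U) = CARD('a) * card U" for U
    by (subst card_image) (auto simp: inj_on_def card_cartesian_product)
  have fg: "?f (?g W) = W" and gU: "is_subspace k (?g W)"
    if W: "is_subspace (Suc k) W" "?e \<in> W" for W
  proof -
    note sub = W(1)[unfolded is_subspace_iff]
    have add: "v + w \<in> W" if "v \<in> W" "w \<in> W" for v w using sub that by blast
    have smult: "c \<cdot>\<^sub>v v \<in> W" if "v \<in> W" for c v using sub that by blast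
    have dim: "v \<in> carrier_vec k" if "vCons a v \<in> W" for a v
      using subsetD[OF conjunct1[OF sub] that] by simp
    have chg: "vCons b v \<in> W" if "vCons a v \<in> W" for a b v
    proof -
      have "vCons a v + (b - a) \<cdot>\<^sub>v ?e = vCons b v"
        using dim[OF that] by (intro eq_vecI) (auto simp: vec_index_vCons)
      then show ?thesis using add[OF that smult[OF W(2), of "b - a"]] by simp
    qed
    show "?f (?g W) = W"
    proof
      show "?f (?g W) \<subseteq> W" using chg by auto
      show "W \<subseteq> ?f (?g W)"
      proof
        fix x assume x: "x \<in> W"
        then have "x \<in> carrier_vec (Suc k)" using sub by blast
        then show "x \<in> ?f (?g W)" using x chg unfolding carrier_vec_Suc by auto
      qed
    qed
    show "is_subspace k (?g W)"
      unfolding is_subspace_iff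
    proof (intro conjI ballI allI)
      show "?g W \<subseteq> carrier_vec k" using dim by blast
      show "0\<^sub>v k \<in> ?g W" using sub by (simp add: zero_vec_Suc)
      show "v + w \<in> ?g W" if "v \<in> ?g W" "w \<in> ?g W" for v w
        using add[of "vCons 0 v" "vCons 0 w"] dim[of 0 v] dim[of 0 w] that by (simp add: vCons_add)
      show "c \<cdot>\<^sub>v v \<in> ?g W" if "v \<in> ?g W" for c v
        using smult[of "vCons 0 v" c] that by (simp add: vCons_smult)
    qed
  qed
  have fU: "is_subspace (Suc k) (?f U)" if U: "is_subspace k U" for U
  proof -
    note sub = U[unfolded is_subspace_iff]
    have c: "dim_vec v = k" if "v \<in> U" for v using sub that by auto
    show ?thesis unfolding is_subspace_iff
      using sub c by (auto simp: zero_vec_Suc vCons_add vCons_smult)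
  qed
  have "bij_betw ?f (subspaces_of_dim k i) {W \<in> subspaces_of_dim (Suc k) (Suc i). ?e \<in> W}"
  proof (rule bij_betwI[where g = ?g])
    show "?f \<in> subspaces_of_dim k i \<rightarrow> {W \<in> subspaces_of_dim (Suc k) (Suc i). ?e \<in> W}"
    proof
      fix U :: "'a vec set" assume U: "U \<in> subspaces_of_dim k i"
      then have "0\<^sub>v k \<in> U" unfolding is_subspace_iff by blast
      then show "?f U \<in> {W \<in> subspaces_of_dim (Suc k) (Suc i). ?e \<in> W}"
        using U fU card_f by auto
    qed
    show "?g \<in> {W \<in> subspaces_of_dim (Suc k) (Suc i). ?e \<in> W} \<rightarrow> subspaces_of_dim k i"
    proof
      fix W assume W: "W \<in> {W \<in> subspaces_of_dim (Suc k) (Suc i). ?e \<in> W}"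
      then have "CARD('a) * card (?g W) = CARD('a) * CARD('a) ^ i"
        using card_f[of "?g W"] fg[of W] by simp
      then have "card (?g W) = CARD('a) ^ i" by simp
      then show "?g W \<in> subspaces_of_dim k i" using W gU[of W] by simp
    qed
  qed (use fg in auto)
  then show ?thesis by (rule bij_betw_same_card[symmetric])
qed

text \<open>A subspace \<open>W\<close> avoiding the first unit vector is mapped injectively when the first coordinate is
  dropped, so it is the graph of a linear functional on its image \<open>U\<close>. Parametrizing \<open>U\<close> by the
  columns of a matrix, such a functional amounts to an arbitrary row vector \<open>c\<close> of length \<open>i\<close>, namely
  its values on the columns; this gives \<open>q\<^sup>i\<close> choices.\<close>

lemma card_subspaces_avoiding_first_unit:
  "card {W :: 'a::{field,finite} vec set \<in> subspaces_of_dim (Suc k) i. vCons 1 (0\<^sub>v k) \<notin> W}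
     = CARD('a) ^ i * card (subspaces_of_dim k i :: 'a vec set set)"
proof -
  let ?e = "vCons 1 (0\<^sub>v k) :: 'a vec"
  let ?A = "{W \<in> subspaces_of_dim (Suc k) i. ?e \<notin> W}"
  define M :: "'a vec set \<Rightarrow> 'a mat" where
    "M U = (SOME M. M \<in> carrier_mat k i \<and> bij_betw ((*\<^sub>v) M) (carrier_vec i) U)" for U
  have M: "M U \<in> carrier_mat k i" and Mbij: "bij_betw ((*\<^sub>v) (M U)) (carrier_vec i) U"
    if "U \<in> subspaces_of_dim k i" for U
  proof -
    have "\<exists>M. M \<in> carrier_mat k i \<and> bij_betw ((*\<^sub>v) M) (carrier_vec i) U"
      using that subspace_parametrization[where n = k and W = U and d = i] by blast
    from someI_ex[OF this] show "M U \<in> carrier_mat k i" "bij_betw ((*\<^sub>v) (M U)) (carrier_vec i) U"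
      unfolding M_def by blast+
  qed
  let ?F = "\<lambda>(U, c). colspace (cons_row c (M U))"
  have F: "colspace (cons_row c (M U)) = (\<lambda>v. vCons (c \<bullet> v) (M U *\<^sub>v v)) ` carrier_vec i"
    if "U \<in> subspaces_of_dim k i" "c \<in> carrier_vec i" for U c
    unfolding colspace_eqI[OF cons_row_carrier[OF M[OF that(1)]]]
    by (rule image_cong) (simp_all add: cons_row_mult_vec[OF that(2) M[OF that(1)]])
  have card_F: "card (colspace (cons_row c (M U))) = CARD('a) ^ i"
    if U: "U \<in> subspaces_of_dim k i" and c: "c \<in> carrier_vec i" for U c
    unfolding F[OF U c] using Mbij[OF U]
    by (subst card_image) (auto simp: inj_on_def bij_betw_def card_carrier_vec)
  have "bij_betw ?F (subspaces_of_dim k i \<times> carrier_vec i) ?A"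
    unfolding bij_betw_def
  proof
    show "inj_on ?F (subspaces_of_dim k i \<times> carrier_vec i)"
    proof (rule inj_onI)
      fix p p' assume p: "p \<in> subspaces_of_dim k i \<times> carrier_vec i"
        and p': "p' \<in> subspaces_of_dim k i \<times> carrier_vec i" and eq: "?F p = ?F p'"
      obtain U c U' c' where pp: "p = (U, c)" "p' = (U', c')" by fastforce
      have U: "U \<in> subspaces_of_dim k i" "U' \<in> subspaces_of_dim k i"
        and c: "c \<in> carrier_vec i" "c' \<in> carrier_vec i" using p p' unfolding pp by auto
      \<comment> \<open>Dropping the first coordinate recovers the subspace; the first coordinates then recover \<open>c\<close>.\<close>
      have proj: "{v. \<exists>a. vCons a v \<in> ?F (V, d)} = V"
        if V: "V \<in> subspaces_of_dim k i" and d: "d \<in> carrier_vec i" for V d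
      proof -
        have "(\<exists>a. vCons a x \<in> ?F (V, d)) \<longleftrightarrow> x \<in> (*\<^sub>v) (M V) ` carrier_vec i" for x
          unfolding prod.case F[OF V d] by (auto simp: image_iff)
        then show ?thesis using Mbij[OF V] unfolding bij_betw_def by auto
      qed
      have UU: "U = U'" using proj[OF U(1) c(1)] proj[OF U(2) c(2)] eq unfolding pp by simp
      have "c \<bullet> v = c' \<bullet> v" if v: "v \<in> carrier_vec i" for v
      proof -
        have "vCons (c \<bullet> v) (M U *\<^sub>v v) \<in> ?F (U', c')"
          using eq v F[OF U(1) c(1)] unfolding pp by auto
        then obtain v' where v': "v' \<in> carrier_vec i" "M U *\<^sub>v v = M U *\<^sub>v v'" "c \<bullet> v = c' \<bullet> v'"
          using F[OF U(2) c(2)] UU by auto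
        then have "v = v'" using Mbij[OF U(1)] v unfolding bij_betw_def inj_on_def by blast
        then show ?thesis using v' by simp
      qed
      then have "c \<bullet> unit_vec i j = c' \<bullet> unit_vec i j" for j by simp
      then have "c $ j = c' $ j" if "j < i" for j using that c by (metis scalar_prod_right_unit)
      then have "c = c'" using c by (intro eq_vecI) auto
      then show "p = p'" using UU pp by simp
    qed
    show "?F ` (subspaces_of_dim k i \<times> carrier_vec i) = ?A"
    proof (intro equalityI subsetI)
      fix W assume "W \<in> ?F ` (subspaces_of_dim k i \<times> carrier_vec i)"
      then obtain U c where U: "U \<in> subspaces_of_dim k i" and c: "c \<in> carrier_vec i"
        and W: "W = colspace (cons_row c (M U))" by auto
      have "?e \<notin> W"
      proof
        assume "?e \<in> W"
        then obtain v where v: "v \<in> carrier_vec i" "c \<bullet> v = 1" "M U *\<^sub>v v = 0\<^sub>v k"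
          unfolding W F[OF U c] by auto
        have "M U *\<^sub>v 0\<^sub>v i = 0\<^sub>v k" using M[OF U] by (intro eq_vecI) auto
        then have "v = 0\<^sub>v i"
          using Mbij[OF U] v unfolding bij_betw_def inj_on_def by simp
        then show False using v c by simp
      qed
      then show "W \<in> ?A"
        using colspace_is_subspace[OF cons_row_carrier[OF M[OF U]]] card_F[OF U c] W by simp
    next
      fix W assume W: "W \<in> ?A"
      then have sW: "is_subspace (Suc k) W" and cW: "card W = CARD('a) ^ i" and eW: "?e \<notin> W" by auto
      note sub = sW[unfolded is_subspace_iff]
      have add: "v + w \<in> W" if "v \<in> W" "w \<in> W" for v w using sub that by blast
      have smult: "c \<cdot>\<^sub>v v \<in> W" if "v \<in> W" for c v using sub that by blast
      have dim: "v \<in> carrier_vec k" if "vCons a v \<in> W" for a v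
        using subsetD[OF conjunct1[OF sub] that] by simp
      have uniq: "a = b" if ab: "vCons a v \<in> W" "vCons b v \<in> W" for a b v
      proof (rule ccontr)
        assume "a \<noteq> b"
        then have "inverse (a - b) \<cdot>\<^sub>v (vCons a v + (-1) \<cdot>\<^sub>v vCons b v) = ?e"
          using dim[OF ab(1)] by (intro eq_vecI) (auto simp: vec_index_vCons)
        then show False using smult[OF add[OF ab(1) smult[OF ab(2)]]] eW by metis
      qed
      define U where "U = {v. \<exists>a. vCons a v \<in> W}"
      \<comment> \<open>The functional on \<open>U\<close> whose graph is \<open>W\<close>.\<close>
      define h where "h v = (SOME a. vCons a v \<in> W)" for v
      have h: "vCons (h v) v \<in> W" if "v \<in> U" for v
        using that unfolding U_def h_def by (auto intro: someI)
      have W_graph: "W = (\<lambda>v. vCons (h v) v) ` U"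
      proof (intro equalityI subsetI)
        fix x assume x: "x \<in> W"
        then have "x \<in> carrier_vec (Suc k)" using sub by blast
        then obtain a v where xav: "x = vCons a v" unfolding carrier_vec_Suc by auto
        then have "v \<in> U" using x unfolding U_def by blast
        then show "x \<in> (\<lambda>v. vCons (h v) v) ` U" using uniq h x xav by blast
      qed (use h in blast)
      have "card W = card U" by (subst W_graph, rule card_image) (simp add: inj_on_def)
      moreover have "is_subspace k U"
        unfolding is_subspace_iff
      proof (intro conjI ballI allI)
        show "U \<subseteq> carrier_vec k" using dim unfolding U_def by blast
        have "vCons 0 (0\<^sub>v k) \<in> W" using sub by (simp add: zero_vec_Suc)
        then show "0\<^sub>v k \<in> U" unfolding U_def by blast
        show "v + w \<in> U" if vw: "v \<in> U" "w \<in> U" for v w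
        proof -
          have "vCons (h v) v + vCons (h w) w = vCons (h v + h w) (v + w)"
            using dim[OF h[OF vw(1)]] dim[OF h[OF vw(2)]] by (simp add: vCons_add)
          then show ?thesis using add[OF h[OF vw(1)] h[OF vw(2)]] unfolding U_def by auto
        qed
        show "c \<cdot>\<^sub>v v \<in> U" if v: "v \<in> U" for c v
          using smult[OF h[OF v], of c] unfolding vCons_smult U_def by blast
      qed
      ultimately have U: "U \<in> subspaces_of_dim k i" using cW by simp
      define c where "c = vec i (\<lambda>j. h (col (M U) j))"
      have c: "c \<in> carrier_vec i" unfolding c_def by simp
      \<comment> \<open>One inclusion suffices, since both subspaces have \<open>q\<^sup>i\<close> elements.\<close>
      have "col (cons_row c (M U)) j \<in> W" if j: "j < i" for j
      proof -
        have "col (M U) j = M U *\<^sub>v unit_vec i j"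
          using M[OF U] j by (intro eq_vecI) auto
        then have "col (M U) j \<in> U" using Mbij[OF U] unfolding bij_betw_def by auto
        moreover have "col (cons_row c (M U)) j = vCons (h (col (M U) j)) (col (M U) j)"
          using j M[OF U] by (intro eq_vecI) (auto simp: cons_row_def c_def vec_index_vCons)
        ultimately show ?thesis using h by simp
      qed
      then have "colspace (cons_row c (M U)) \<subseteq> W"
        by (rule colspace_least[OF cons_row_carrier[OF M[OF U]] sW])
      then have "colspace (cons_row c (M U)) = W"
        using card_subset_eq[OF is_subspace_finite[OF sW]] card_F[OF U c] cW by simp
      then show "W \<in> ?F ` (subspaces_of_dim k i \<times> carrier_vec i)"
        using U c by (intro image_eqI[of _ _ "(U, c)"]) auto
    qed
  qed
  from bij_betw_same_card[OF this] show ?thesis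
    by (simp add: card_cartesian_product card_carrier_vec mult.commute)
qed

lemma gauss_binomial_0_right: "gauss_binomial TYPE('a::{field,finite}) k 0 = 1"
proof -
  have "(subspaces_of_dim k 0 :: 'a vec set set) = {{0\<^sub>v k}}"
  proof (intro equalityI subsetI)
    fix W :: "'a vec set" assume W: "W \<in> subspaces_of_dim k 0"
    then obtain x where "W = {x}" using card_1_singletonE by auto
    then show "W \<in> {{0\<^sub>v k}}" using W by (auto simp: is_subspace_iff)
  qed (auto simp: is_subspace_iff)
  then show ?thesis unfolding gauss_binomial_eq_card by simp
qed

lemma gauss_binomial_0_Suc: "gauss_binomial TYPE('a::{field,finite}) 0 (Suc i) = 0"
proof -
  have "card W \<le> 1" if "is_subspace 0 W" for W :: "'a vec set"
    using card_mono[OF finite_carrier_vec, of W 0] that by (simp add: is_subspace_iff card_carrier_vec)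
  moreover have "1 < CARD('a) ^ Suc i"
    using one_less_card_field[where 'a='a] by (intro one_less_power) auto
  ultimately have "subspaces_of_dim 0 (Suc i) = ({} :: 'a vec set set)" by fastforce
  then show ?thesis unfolding gauss_binomial_eq_card by (simp only: card.empty)
qed

lemma gauss_binomial_Suc_Suc:
  "gauss_binomial TYPE('a::{field,finite}) (Suc k) (Suc i)
     = CARD('a) ^ Suc i * gauss_binomial TYPE('a) k (Suc i) + gauss_binomial TYPE('a) k i"
proof -
  let ?S = "subspaces_of_dim (Suc k) (Suc i) :: 'a vec set set" and ?e = "vCons 1 (0\<^sub>v k) :: 'a vec"
  have split: "?S = {W \<in> ?S. ?e \<notin> W} \<union> {W \<in> ?S. ?e \<in> W}" by blast
  have "card ?S = card {W \<in> ?S. ?e \<notin> W} + card {W \<in> ?S. ?e \<in> W}"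
    by (subst split, rule card_Un_disjoint)
      (auto intro: finite_subset[OF _ finite_subspaces_of_dim[where k = "Suc k" and i = "Suc i"]])
  then show ?thesis
    unfolding gauss_binomial_eq_card
      card_subspaces_containing_first_unit card_subspaces_avoiding_first_unit .
qed

section \<open>The recursion for the alternating sum\<close>

lemma g_sum_0: "g_sum TYPE('a::{field,finite}) n r 0 = int (rank_count TYPE('a) n r)"
proof -
  have "g_sum TYPE('a) n r 0 = (\<Sum>i=0..r. if i = 0 then int (rank_count TYPE('a) n r) else 0)"
    unfolding g_sum_def
    by (rule sum.cong) (auto simp: gauss_binomial_0_right gauss_binomial_0_Suc gr0_conv_Suc numeral_2_eq_2)
  then show ?thesis by simp
qed

text \<open>The ring identity behind the term-by-term recursion. Here \<open>m = (-1)\<^sup>i\<close>, \<open>x = q\<^sup>i\<close>, \<open>D = q\<^sup>d\<close> and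
  \<open>K = q\<^bsup>k d\<^esup>\<close> for \<open>d = s - i\<close>, while \<open>C\<close> is \<open>q\<close> to the power \<open>i choose 2\<close>, and \<open>b\<close>, \<open>b'\<close>, \<open>a\<close> are the
  two Gaussian binomials and the rank count.\<close>

lemma pascal_term_identity:
  fixes m C x K D q b b' a :: int
  shows "- 1 * m * (C * x * (K * D)) * (q * x * b + b') * a
    = q * (x * D) * (- 1 * m * (C * x * K) * b * a) - x * D * (m * (C * K) * b' * a)"
  by (simp add: algebra_simps)

text \<open>The Pascal rule splits the term with index \<open>i + 1\<close> into the corresponding term for \<open>(k, r)\<close> and
  the term with index \<open>i\<close> for \<open>(k, r - 1)\<close>. The sign of the second part comes from the index shift,
  and its exponent from \<open>(i + 1 choose 2) = (i choose 2) + i\<close>.\<close>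

lemma g_sum_Suc:
  "g_sum TYPE('a::{field,finite}) (Suc n) r (Suc k) = int CARD('a) ^ r * g_sum TYPE('a) n r k
    - (if r = 0 then 0 else int CARD('a) ^ (r - 1) * g_sum TYPE('a) n (r - 1) k)"
proof -
  let ?q = "int CARD('a)" and ?a = "\<lambda>s. int (rank_count TYPE('a) (n - k) s)"
  let ?b = "\<lambda>k i. int (gauss_binomial TYPE('a) k i)"
  define t where "t k r i = (-1) ^ i * ?q ^ ((i choose 2) + k * (r - i)) * ?b k i * ?a (r - i)" for k r i
  have g: "g_sum TYPE('a) (Suc n) r (Suc k) = (\<Sum>i=0..r. t (Suc k) r i)"
    "\<And>r. g_sum TYPE('a) n r k = (\<Sum>i=0..r. t k r i)"
    unfolding g_sum_def t_def by simp_all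
  have head: "t (Suc k) r 0 = ?q ^ r * t k r 0"
    unfolding t_def by (simp add: gauss_binomial_0_right power_add)
  show ?thesis
  proof (cases r)
    case 0
    then show ?thesis using head unfolding g by simp
  next
    case (Suc s)
    have tail: "t (Suc k) (Suc s) (Suc i) = ?q ^ Suc s * t k (Suc s) (Suc i) - ?q ^ s * t k s i"
      if is_le: "i \<le> s" for i
    proof -
      obtain d where s: "s = i + d" using le_Suc_ex[OF is_le] ..
      have d: "Suc s - Suc i = d" "s - i = d" unfolding s by simp_all
      have c: "Suc i choose 2 = (i choose 2) + i" by (simp add: numeral_2_eq_2)
      have b: "?b (Suc k) (Suc i) = ?q * ?q ^ i * ?b k (Suc i) + ?b k i"
        unfolding gauss_binomial_Suc_Suc by simp
      have pow: "?q ^ ((Suc i choose 2) + Suc k * d) = ?q ^ (i choose 2) * ?q ^ i * (?q ^ (k * d) * ?q ^ d)"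
        "?q ^ ((Suc i choose 2) + k * d) = ?q ^ (i choose 2) * ?q ^ i * ?q ^ (k * d)"
        "?q ^ ((i choose 2) + k * d) = ?q ^ (i choose 2) * ?q ^ (k * d)"
        "?q ^ Suc s = ?q * (?q ^ i * ?q ^ d)" "?q ^ s = ?q ^ i * ?q ^ d"
        unfolding c s by (simp_all add: power_add)
      show ?thesis unfolding t_def d pow b power_Suc[of "- 1"] by (rule pascal_term_identity)
    qed
    have "(\<Sum>i=0..r. t (Suc k) r i) = t (Suc k) r 0 + (\<Sum>i=0..s. t (Suc k) (Suc s) (Suc i))"
      unfolding Suc sum.atLeast0_atMost_Suc_shift by simp
    also have "(\<Sum>i=0..s. t (Suc k) (Suc s) (Suc i))
        = (\<Sum>i=0..s. ?q ^ Suc s * t k (Suc s) (Suc i) - ?q ^ s * t k s i)"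
      by (rule sum.cong) (simp_all only: tail atLeastAtMost_iff)
    also have "\<dots> = ?q ^ r * (\<Sum>i=0..s. t k (Suc s) (Suc i)) - ?q ^ s * (\<Sum>i=0..s. t k s i)"
      unfolding Suc sum_subtractf sum_distrib_left ..
    also have "t (Suc k) r 0 + (?q ^ r * (\<Sum>i=0..s. t k (Suc s) (Suc i)) - ?q ^ s * (\<Sum>i=0..s. t k s i))
        = ?q ^ r * (t k r 0 + (\<Sum>i=0..s. t k (Suc s) (Suc i))) - ?q ^ s * (\<Sum>i=0..s. t k s i)"
      unfolding head by (simp only: distrib_left add_diff_eq)
    also have "t k r 0 + (\<Sum>i=0..s. t k (Suc s) (Suc i)) = (\<Sum>i=0..r. t k r i)"
      unfolding Suc sum.atLeast0_atMost_Suc_shift by simp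
    finally show ?thesis unfolding g using Suc by simp
  qed
qed

section \<open>Counting matrices by rank and partial trace\<close>

lemma weighted_count_0:
  "weighted_count (\<phi> :: 'a::{field,finite} \<Rightarrow> int) n r 0 = \<phi> 0 * int (rank_count TYPE('a) n r)"
proof -
  have "weighted_count \<phi> n r 0 = (\<Sum>X\<in>carrier_mat n n \<inter> {X :: 'a mat. vec_space.rank n X = r}. \<phi> 0)"
    unfolding weighted_count_def by simp
  also have "\<dots> = \<phi> 0 * int (rank_count TYPE('a) n r)"
    unfolding rank_count_def by (simp add: Int_def)
  finally show ?thesis .
qed

text \<open>Both sides obey the same recursion in \<open>k\<close> and agree for \<open>k = 0\<close>, where the partial trace is the
  empty sum.\<close>

lemma weighted_count_eq_g_sum:
  fixes \<phi> :: "'a::{field,finite} \<Rightarrow> int"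
  assumes \<phi>: "(\<Sum>x\<in>UNIV. \<phi> x) = 0"
  shows "k \<le> n \<Longrightarrow> weighted_count \<phi> n r k = \<phi> 0 * g_sum TYPE('a) n r k"
proof (induction k arbitrary: n r)
  case 0
  show ?case unfolding weighted_count_0 g_sum_0 ..
next
  case (Suc k)
  then obtain m where m: "n = Suc m" "k \<le> m" by (cases n) auto
  show ?case unfolding m weighted_count_Suc[OF m(2) \<phi>] g_sum_Suc Suc.IH[OF m(2)]
    by (simp add: algebra_simps)
qed

lemma weighted_count_eq_sum_partial_trace_count:
  "weighted_count \<phi> n r k = (\<Sum>x\<in>UNIV. \<phi> x * int (partial_trace_count n r k (x :: 'a::{field,finite})))"
proof -
  let ?S = "{X :: 'a mat \<in> carrier_mat n n. vec_space.rank n X = r}"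
  let ?T = "\<lambda>X :: 'a mat. \<Sum>j<k. X $$ (j, j)"
  have fin: "finite ?S" by simp
  have "weighted_count \<phi> n r k = (\<Sum>X\<in>?S. \<phi> (?T X))"
    unfolding weighted_count_def by (simp add: Int_def)
  also have "\<dots> = (\<Sum>x\<in>UNIV. \<Sum>X\<in>{X \<in> ?S. ?T X = x}. \<phi> (?T X))"
    by (rule sum.group[symmetric]) (use fin in auto)
  also have "\<dots> = (\<Sum>x\<in>UNIV. \<phi> x * int (partial_trace_count n r k x))"
    unfolding partial_trace_count_def by (rule sum.cong) (simp_all add: conj_assoc)
  finally show ?thesis .
qed

lemma rank_smult_nonzero:
  fixes X :: "'a::{field,finite} mat"
  assumes X: "X \<in> carrier_mat n m" and c: "c \<noteq> 0"
  shows "vec_space.rank n (c \<cdot>\<^sub>m X) = vec_space.rank n X"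
proof (rule rank_eqI)
  show cX: "c \<cdot>\<^sub>m X \<in> carrier_mat n m" using X by simp
  note sub = colspace_is_subspace[OF X, unfolded is_subspace_iff]
  have "colspace (c \<cdot>\<^sub>m X) = (\<lambda>v. c \<cdot>\<^sub>v v) ` colspace X"
    unfolding colspace_eqI[OF cX] colspace_eqI[OF X] image_image
    using X by (intro image_cong refl eq_vecI) auto
  moreover have "inj_on (\<lambda>v. c \<cdot>\<^sub>v v) (colspace X)"
    by (rule inj_on_inverseI[of _ "\<lambda>v. inverse c \<cdot>\<^sub>v v"]) (use c in \<open>simp add: smult_smult_assoc\<close>)
  ultimately show "card (colspace (c \<cdot>\<^sub>m X)) = CARD('a) ^ vec_space.rank n X"
    by (simp add: card_image card_colspace[OF X])
qed

text \<open>Multiplication by the inverse of \<open>\<alpha>\<close> preserves the rank and turns partial trace \<open>\<alpha>\<close> into \<open>1\<close>.\<close>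

lemma partial_trace_count_nonzero:
  fixes \<alpha> :: "'a::{field,finite}"
  assumes k: "k \<le> n" and \<alpha>: "\<alpha> \<noteq> 0"
  shows "partial_trace_count n r k \<alpha> = partial_trace_count n r k (1 :: 'a)"
proof -
  have trace: "(\<Sum>j<k. (c \<cdot>\<^sub>m X) $$ (j, j)) = c * (\<Sum>j<k. X $$ (j, j))"
    if "X \<in> carrier_mat n n" for c and X :: "'a mat"
    using that k by (auto simp: sum_distrib_left intro!: sum.cong)
  have "bij_betw (\<lambda>X. inverse \<alpha> \<cdot>\<^sub>m X)
      {X. X \<in> carrier_mat n n \<and> vec_space.rank n X = r \<and> (\<Sum>j<k. X $$ (j, j)) = \<alpha>}
      {X. X \<in> carrier_mat n n \<and> vec_space.rank n X = r \<and> (\<Sum>j<k. X $$ (j, j)) = 1}"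
    by (rule bij_betwI[where g = "\<lambda>X. \<alpha> \<cdot>\<^sub>m X"])
      (use \<alpha> in \<open>auto simp: trace rank_smult_nonzero[where m = n] intro!: eq_matI\<close>)
  then show ?thesis unfolding partial_trace_count_def by (rule bij_betw_same_card)
qed

theorem theorem1p1:
  fixes n r k q :: nat
  assumes "CARD('a::{field,finite}) = q"
    and "1 \<le> k" and "k \<le> n" and "r \<le> n"
  shows "real (partial_trace_count n r k (1::'a))
             = (real (rank_count TYPE('a) n r) - real_of_int (g_sum TYPE('a) n r k)) / real q
         \<and> real (partial_trace_count n r k (0::'a))
             = (real (rank_count TYPE('a) n r) + (real q - 1) * real_of_int (g_sum TYPE('a) n r k)) / real q"
proof -
  let ?f = "\<lambda>\<alpha> :: 'a. int (partial_trace_count n r k \<alpha>)"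
  let ?a = "int (rank_count TYPE('a) n r)" and ?g = "g_sum TYPE('a) n r k"
  have split: "(\<Sum>x\<in>UNIV. \<phi> x * ?f x) = \<phi> 0 * ?f 0 + (\<Sum>x\<in>UNIV - {0}. \<phi> x) * ?f 1" for \<phi> :: "'a \<Rightarrow> int"
  proof -
    have "(\<Sum>x\<in>UNIV - {0}. \<phi> x * ?f x) = (\<Sum>x\<in>UNIV - {0}. \<phi> x * ?f 1)"
      by (intro sum.cong refl arg_cong2[where f = "(*)"] arg_cong[where f = int]
          partial_trace_count_nonzero[OF assms(3)]) simp
    then show ?thesis by (subst sum.remove[of _ 0]) (simp_all add: sum_distrib_right)
  qed
  have q: "q \<ge> 2" using one_less_card_field[where 'a='a] assms(1) by simp
  have card: "int (card (UNIV - {0 :: 'a})) = int q - 1"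
    using q assms(1) by (simp add: card_Diff_subset of_nat_diff)
  \<comment> \<open>The constant weight counts all matrices of rank \<open>r\<close>.\<close>
  have "weighted_count (\<lambda>_ :: 'a. 1) n r k = ?a"
    using weighted_count_0[of "\<lambda>_ :: 'a. 1" n r] unfolding weighted_count_def by simp
  then have total: "?a = ?f 0 + (int q - 1) * ?f 1"
    using weighted_count_eq_sum_partial_trace_count[of "\<lambda>_ :: 'a. 1" n r k] split[of "\<lambda>_. 1"] card by simp
  \<comment> \<open>This weight has total zero and separates the partial traces \<open>0\<close> and \<open>1\<close>.\<close>
  let ?\<phi> = "\<lambda>x :: 'a. of_bool (x = 0) - of_bool (x = 1) :: int"
  have \<phi>: "(\<Sum>x\<in>UNIV. ?\<phi> x) = 0" by (simp add: sum_subtractf)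
  then have "(\<Sum>x\<in>UNIV - {0}. ?\<phi> x) = - 1" by (subst (asm) sum.remove[of _ 0]) simp_all
  then have "?f 0 - ?f 1 = ?g"
    using weighted_count_eq_g_sum[OF \<phi> assms(3), of r]
      weighted_count_eq_sum_partial_trace_count[of ?\<phi> n r k] split[of ?\<phi>] by simp
  then have diff: "?g = ?f 0 - ?f 1" ..
  have "real_of_int ?a = real_of_int (?f 0 + (int q - 1) * ?f 1)" unfolding total ..
  then show ?thesis using q unfolding diff by (simp add: field_simps)
qed

end
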